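(* Let $d\ge1$ and $\rho\in[0,1]$. Let $(\eta_t)_{t\ge0}$ and $(\hat\eta_t)_{t\ge0}$ be the hard-core birth-death processes with parameter $\rho$ driven by the same marked Poisson process $N'$ on $\mathbb{R}^d\times\mathbb{R}^+$, where $\eta_0$ is a spatially stationary and ergodic hard-core point process and $\hat\eta_0=\Upsilon_0$ is the stationary regime at time $0$. Let $L_t(f)=\mathbb{E}\,e^{-\int f\,d\eta_t}$ and $\hat L_t(f)=\mathbb{E}\,e^{-\int f\,d\hat\eta_t}$ be the Laplace functionals of $\eta_t$ and $\hat\eta_t$. Let $S_t=\eta_t\triangle\hat\eta_t$, with intensity $\beta_{S_t}$. If there exists $c>0$ such that $\beta_{S_t}\le\beta_{S_0}e^{-ct}$ for all $t\ge0$, then for any $f\in BM_+(\mathbb{R}^d)$ and $t\ge0$, $$|L_t(f)-\hat L_t(f)|\le\|f\|_{L^1}\,\beta_{S_0}\,e^{-ct}.$$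
   Context: $BM_+(\mathbb{R}^d)$ is the set of non-negative bounded measurable functions on $\mathbb{R}^d$ vanishing outside a bounded set. Configurations are locally finite subsets of $\mathbb{R}^d$, identified with simple counting measures. $B(x,r)$ is the closed ball of radius $r$ centered at $x$. A configuration is hard-core if any two of its distinct points are at distance greater than $1$; a point process is hard-core if it is almost surely a hard-core configuration. The intensity of a stationary point process is its expected number of points in a set of Lebesgue measure $1$. Hard-core birth-death process with parameter $\rho$ driven by a Poisson process: the driving process is a homogeneous Poisson point process on $\mathbb{R}^d\times\mathbb{R}^+$ with intensity $\lambda=1$, independent of the initial configurations; a point $p=(x_p,t_p)$ arrives at location $x_p$ at time $t_p$; initial points have arrival time $0$. For an arriving point $p$ and a point $q$ (arriving or initial) with $t_q<t_p$, the mark $I_{p,q}$ is Bernoulli with parameter $\rho$ and $I_{q,p}=1-I_{p,q}$; marks are independent over different pairs $\{p,q\}$ and independent of the rest. When $p$ arrives at time $t=t_p$, each point $q$ with $x_q\in\eta_{t-}\cap B(x_p,1)$ is deleted iff $I_{p,q}=1$ (it survives iff $I_{q,p}=1$), and $p$ is accepted (i.e. $x_p\in\eta_t$) iff $I_{p,q}=1$ for all $q$ with $x_q\in\eta_{t-}\cap B(x_p,1)$; points outside $B(x_p,1)$ are unaffected. No other changes occur, and $\eta_t$ restricted to any compact set is a right-continuous jump process. Construction: fix $\epsilon>0$ so small that, almost surely, for every $n\ge0$, the graph on the spatial projections of the points arriving in $[n\epsilon,(n+1)\epsilon]$, joining points at distance at most $2$, has only finite connected components; successively on each such interval, given $\eta_{n\epsilon}$,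 decide acceptance of the points of each finite component in order of arrival by the rule that an arriving point $p$ is accepted iff $I_{p,q}=1$ for all $q$ with $x_q\in\eta_{t_p-}\cap B(x_p,1)$, while each such $q$ is deleted iff $I_{p,q}=1$. The process started at another time is defined analogously. Stationary regime: let $N$ be a homogeneous Poisson point process on $\mathbb{R}^d\times\mathbb{R}$ with intensity $\lambda=1$, with marks $I_{p,q}$ for $p,q\in N$, $t_q<t_p$, that are Bernoulli with parameter $\rho$, with $I_{q,p}=1-I_{p,q}$, independent over different pairs $\{p,q\}$ and independent of $N$, and for $T\in\mathbb{N}$ let $\eta^T_t$, $t\ge-T$, be the process driven by $N$ started from the empty configuration at time $-T$. It is assumed that $\Upsilon_t=\lim_{T\to\infty}\eta^T_t$ exists almost surely for all $t\in\mathbb{R}$, in the sense that for every compact $C$ the restrictions $\eta^T_t|_C$ are constant for all large $T$; $(\Upsilon_t)$ is the stationary regime. The pair $(\eta_0,\Upsilon_0)$ is independent of $N'$ and its marks, and is jointly stationary under translations of $\mathbb{R}^d$, so that $S_t$ is a stationary point process. *)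

theory Defs
  imports "HOL-Probability.Probability"
begin

definition configurations :: "'b::euclidean_space set set" where
  "configurations = {X. \<forall>C. compact C \<longrightarrow> finite (X \<inter> C)}"

definition config_space :: "'b::euclidean_space set measure" where
  "config_space = sigma configurations
     {{X \<in> configurations. card (X \<inter> B) = n} | B n. B \<in> sets borel \<and> bounded B}"

definition point_process :: "'w measure \<Rightarrow> ('w \<Rightarrow> 'b::euclidean_space set) \<Rightarrow> bool" where
  "point_process M X \<longleftrightarrow> X \<in> M \<rightarrow>\<^sub>M config_space"

definition hard_core :: "'a::euclidean_space set \<Rightarrow> bool" where
  "hard_core X \<longleftrightarrow> (\<forall>x\<in>X. \<forall>y\<in>X. x \<noteq> y \<longrightarrow> dist x y > 1)"

definition translate :: "'b::euclidean_space \<Rightarrow> 'b set \<Rightarrow> 'b set" where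
  "translate a X = (\<lambda>x. a + x) ` X"

definition stationary :: "'w measure \<Rightarrow> ('w \<Rightarrow> 'a::euclidean_space set) \<Rightarrow> bool" where
  "stationary M X \<longleftrightarrow>
     (\<forall>a. distr M config_space (\<lambda>\<omega>. translate a (X \<omega>)) = distr M config_space X)"

definition jointly_stationary ::
  "'w measure \<Rightarrow> ('w \<Rightarrow> 'a::euclidean_space set) \<Rightarrow> ('w \<Rightarrow> 'a set) \<Rightarrow> bool" where
  "jointly_stationary M X Y \<longleftrightarrow>
     (\<forall>a. distr M (config_space \<Otimes>\<^sub>M config_space) (\<lambda>\<omega>. (translate a (X \<omega>), translate a (Y \<omega>)))
        = distr M (config_space \<Otimes>\<^sub>M config_space) (\<lambda>\<omega>. (X \<omega>, Y \<omega>)))"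

text \<open>Ergodicity: events that are invariant under all translations have probability 0 or 1.\<close>

definition ergodic :: "'w measure \<Rightarrow> ('w \<Rightarrow> 'a::euclidean_space set) \<Rightarrow> bool" where
  "ergodic M X \<longleftrightarrow>
     (\<forall>E\<in>sets config_space. (\<forall>a. \<forall>Z\<in>configurations. translate a Z \<in> E \<longleftrightarrow> Z \<in> E) \<longrightarrow>
        measure M {\<omega> \<in> space M. X \<omega> \<in> E} \<in> {0, 1})"

text \<open>The intensity is defined for stationary processes, where the expected number of points in a
  set of volume 1 does not depend on the set; hence the quantifier over all such sets.\<close>

definition has_intensity :: "'w measure \<Rightarrow> ('w \<Rightarrow> 'a::euclidean_space set) \<Rightarrow> real \<Rightarrow> bool" where
  "has_intensity M X \<beta> \<longleftrightarrow> point_process M X \<and> 0 \<le> \<beta> \<and>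
     (\<forall>A\<in>sets borel. emeasure lborel A = 1 \<longrightarrow>
        (\<integral>\<^sup>+\<omega>. emeasure (count_space UNIV) (X \<omega> \<inter> A) \<partial>M) = ennreal \<beta>)"

definition BM_plus :: "('a::euclidean_space \<Rightarrow> real) set" where
  "BM_plus = {f \<in> borel_measurable borel.
     (\<forall>x. 0 \<le> f x) \<and> bounded (range f) \<and> bounded {x. f x \<noteq> 0}}"

text \<open>A configuration is identified with the counting measure on it.\<close>

definition laplace_functional ::
  "'w measure \<Rightarrow> ('w \<Rightarrow> 'a::euclidean_space set) \<Rightarrow> ('a \<Rightarrow> real) \<Rightarrow> real" where
  "laplace_functional M X f = (\<integral>\<omega>. exp (- (\<integral>x. f x \<partial>count_space (X \<omega>))) \<partial>M)"

text \<open>The counts are required to be Poisson on bounded Borel sets only. The mass function is written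
  out because \<^const>\<open>poisson_pmf\<close> does not cover rate 0.\<close>

definition poisson_process ::
  "'w measure \<Rightarrow> 'b::euclidean_space measure \<Rightarrow> ('w \<Rightarrow> 'b set) \<Rightarrow> bool" where
  "poisson_process M \<Lambda> N \<longleftrightarrow> point_process M N \<and>
     (\<forall>B\<in>sets borel. bounded B \<longrightarrow> (\<forall>k.
        measure M {\<omega> \<in> space M. card (N \<omega> \<inter> B) = k}
          = measure \<Lambda> B ^ k / fact k * exp (- measure \<Lambda> B))) \<and>
     (\<forall>(n::nat) B. (\<forall>i<n. B i \<in> sets borel \<and> bounded (B i)) \<and> disjoint_family_on B {..<n} \<longrightarrow>
        prob_space.indep_vars M (\<lambda>_. count_space UNIV) (\<lambda>i \<omega>. card (N \<omega> \<inter> B i)) {..<n})"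

text \<open>A space-time point \<open>p = (x, t)\<close> consists of a location and an arrival time, and
  \<open>I \<omega> p q\<close> says that the mark of \<open>(p, q)\<close> is 1. Marks are only meaningful on the random set
  \<open>P\<close>, which is a part of the data generating the sub-sigma-algebra \<open>G\<close>. Conditionally on \<open>G\<close>, the
  marks are independent Bernoulli variables: they may be read off along any finite family of
  \<open>G\<close>-measurable selections of distinct pairs. Only pairs with \<open>q\<close> older than \<open>p\<close> are
  considered, so each unordered pair occurs once.\<close>

definition bernoulli_marks ::
  "'w measure \<Rightarrow> 'w measure \<Rightarrow> real \<Rightarrow> ('w \<Rightarrow> ('a::euclidean_space \<times> real) set) \<Rightarrow>
   ('w \<Rightarrow> 'a \<times> real \<Rightarrow> 'a \<times> real \<Rightarrow> bool) \<Rightarrow> bool" where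
  "bernoulli_marks M G \<rho> P I \<longleftrightarrow>
     (AE \<omega> in M. \<forall>p\<in>P \<omega>. \<forall>q\<in>P \<omega>. snd q < snd p \<longrightarrow> (I \<omega> q p \<longleftrightarrow> \<not> I \<omega> p q)) \<and>
     (\<forall>(n::nat) p q b A.
        A \<in> sets G \<and>
        (\<forall>k<n. p k \<in> G \<rightarrow>\<^sub>M borel \<and> q k \<in> G \<rightarrow>\<^sub>M borel) \<and>
        (\<forall>\<omega>\<in>A. (\<forall>k<n. p k \<omega> \<in> P \<omega> \<and> q k \<omega> \<in> P \<omega> \<and> snd (q k \<omega>) < snd (p k \<omega>)) \<and>
               inj_on (\<lambda>k. (p k \<omega>, q k \<omega>)) {..<n}) \<longrightarrow>
        {\<omega> \<in> A. \<forall>k<n. I \<omega> (p k \<omega>) (q k \<omega>) = b k} \<in> sets M \<and>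
        measure M {\<omega> \<in> A. \<forall>k<n. I \<omega> (p k \<omega>) (q k \<omega>) = b k}
          = measure M A * (\<Prod>k<n. if b k then \<rho> else 1 - \<rho>))"

text \<open>A path \<open>H\<close> records the living points together with their arrival times, so that the marks
  between an arriving point and the living ones can be looked up; the configuration at time \<open>t\<close>
  is \<open>fst ` H t\<close>.\<close>

definition left_limit :: "(real \<Rightarrow> 'b set) \<Rightarrow> real \<Rightarrow> 'b set" where
  "left_limit H t = {q. \<forall>\<^sub>F r in at_left t. q \<in> H r}"

text \<open>The path starts at time \<open>s\<close> from \<open>u\<close> and is driven by the arrivals \<open>n\<close> with marks \<open>I\<close>. The
  second clause states both the rule at an arrival and that nothing else changes. The last
  one states that the path is a right-continuous jump function on every compact set. If
  the graphs in the construction on successive time intervals have finite components (almost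
  surely the case for Poisson arrivals), this determines the path uniquely.\<close>

definition hard_core_evolution ::
  "('a::euclidean_space \<times> real) set \<Rightarrow> ('a \<times> real \<Rightarrow> 'a \<times> real \<Rightarrow> bool) \<Rightarrow> real \<Rightarrow> 'a set \<Rightarrow>
   (real \<Rightarrow> ('a \<times> real) set) \<Rightarrow> bool" where
  "hard_core_evolution n I s u H \<longleftrightarrow>
     H s = u \<times> {s} \<and>
     (\<forall>t>s. H t =
        {q \<in> left_limit H t. \<forall>p\<in>n. snd p = t \<and> fst q \<in> cball (fst p) 1 \<longrightarrow> \<not> I p q} \<union>
        {p \<in> n. snd p = t \<and> (\<forall>q\<in>left_limit H t. fst q \<in> cball (fst p) 1 \<longrightarrow> I p q)}) \<and>
     (\<forall>C. compact C \<longrightarrow>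
        (\<forall>t\<ge>s. \<forall>\<^sub>F r in at_right t. H r \<inter> C \<times> UNIV = H t \<inter> C \<times> UNIV) \<and>
        (\<forall>t>s. \<forall>\<^sub>F r in at_left t. H r \<inter> C \<times> UNIV = left_limit H t \<inter> C \<times> UNIV))"

definition hard_core_process ::
  "'w measure \<Rightarrow> ('w \<Rightarrow> ('a::euclidean_space \<times> real) set) \<Rightarrow>
   ('w \<Rightarrow> 'a \<times> real \<Rightarrow> 'a \<times> real \<Rightarrow> bool) \<Rightarrow> real \<Rightarrow> (real \<Rightarrow> 'w \<Rightarrow> 'a set) \<Rightarrow> bool" where
  "hard_core_process M N I s \<eta> \<longleftrightarrow>
     (\<forall>t\<ge>s. point_process M (\<eta> t)) \<and>
     (AE \<omega> in M. \<exists>H. hard_core_evolution (N \<omega>) (I \<omega>) s (\<eta> s \<omega>) H \<and>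
                      (\<forall>t\<ge>s. \<eta> t \<omega> = fst ` H t))"

text \<open>Unit-rate Poisson arrivals on \<open>R\<^sup>d \<times> [0, \<infinity>)\<close> drive processes started at time 0 from \<open>X\<close> and
  from \<open>Y\<close>. The marks between arriving and initial points are shared as well: a location
  belonging to both initial configurations is one initial point, with arrival time 0. The marks
  are independent of the arrivals, of \<open>X\<close> and of \<open>Y\<close>, jointly.\<close>

definition common_driving ::
  "'w measure \<Rightarrow> real \<Rightarrow> ('w \<Rightarrow> ('a::euclidean_space \<times> real) set) \<Rightarrow>
   ('w \<Rightarrow> 'a \<times> real \<Rightarrow> 'a \<times> real \<Rightarrow> bool) \<Rightarrow> ('w \<Rightarrow> 'a set) \<Rightarrow> ('w \<Rightarrow> 'a set) \<Rightarrow> bool" where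
  "common_driving M \<rho> N I X Y \<longleftrightarrow>
     poisson_process M (density lborel (indicator (UNIV \<times> {0..}))) N \<and>
     prob_space.indep_set M
       (sets (vimage_algebra (space M) (\<lambda>\<omega>. (X \<omega>, Y \<omega>)) (config_space \<Otimes>\<^sub>M config_space)))
       (sets (vimage_algebra (space M) N config_space)) \<and>
     bernoulli_marks M
       (vimage_algebra (space M) (\<lambda>\<omega>. (N \<omega>, X \<omega>, Y \<omega>))
          (config_space \<Otimes>\<^sub>M (config_space \<Otimes>\<^sub>M config_space)))
       \<rho> (\<lambda>\<omega>. N \<omega> \<union> (X \<omega> \<union> Y \<omega>) \<times> {0}) I"

definition stationary_regime ::
  "'w measure \<Rightarrow> real \<Rightarrow> ('w \<Rightarrow> ('a::euclidean_space \<times> real) set) \<Rightarrow>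
   ('w \<Rightarrow> 'a \<times> real \<Rightarrow> 'a \<times> real \<Rightarrow> bool) \<Rightarrow> (real \<Rightarrow> 'w \<Rightarrow> 'a set) \<Rightarrow> bool" where
  "stationary_regime M \<rho> N I \<Upsilon> \<longleftrightarrow>
     poisson_process M lborel N \<and>
     bernoulli_marks M (vimage_algebra (space M) N config_space) \<rho> N I \<and>
     (\<forall>t. point_process M (\<Upsilon> t)) \<and>
     (\<exists>\<eta> :: nat \<Rightarrow> real \<Rightarrow> 'w \<Rightarrow> 'a set.
        (\<forall>T. hard_core_process M N I (- real T) (\<eta> T) \<and>
             (AE \<omega> in M. \<eta> T (- real T) \<omega> = {})) \<and>
        (\<forall>t. AE \<omega> in M. \<forall>C. compact C \<longrightarrow>
           (\<forall>\<^sub>F T in sequentially. \<eta> T t \<omega> \<inter> C = \<Upsilon> t \<omega> \<inter> C)))"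

end

theory Submission
  imports Defs
begin

text \<open>Since \<open>x \<mapsto> exp (- x)\<close> is 1-Lipschitz on the nonnegative reals, the two Laplace functionals
  differ by at most the expected sum of \<open>f\<close> over the symmetric difference, which by Campbell's
  formula is its intensity times the integral of \<open>f\<close>. As the intensity only
  prescribes the expected number of points in sets of volume exactly 1, Campbell's formula
  rests on the fact that a measure constant on those sets is a multiple of Lebesgue measure.\<close>

section \<open>Measures that are constant on the sets of volume 1\<close>

text \<open>A box with one side of length \<open>a\<close> and all other sides of length 1 has
  volume \<open>a\<close> in every dimension. Pushed along a basis vector beyond a radius that
  bounds \<open>K\<close>, it cannot meet \<open>K\<close>.\<close>

lemma ex_disjoint_lborel:
  fixes K :: "'a::euclidean_space set"
  assumes "bounded K" "0 \<le> a"
  obtains D where "D \<in> sets borel" "bounded D" "emeasure lborel D = ennreal a" "K \<inter> D = {}"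
proof -
  obtain r where r: "\<And>x. x \<in> K \<Longrightarrow> norm x \<le> r"
    using \<open>bounded K\<close> by (auto simp: bounded_iff)
  obtain e :: 'a where e: "e \<in> Basis"
    using nonempty_Basis by blast
  \<comment> \<open>On the box the coordinate along \<open>e\<close> exceeds \<open>r\<close>, hence
    so does the norm. In \<open>v\<close>, adding \<open>One\<close> gives all sides length 1, and
    the last summand changes the side along \<open>e\<close> to \<open>a\<close>.\<close>
  define u where "u = r *\<^sub>R e"
  define v where "v = u + One + (a - 1) *\<^sub>R e"
  have diff: "(v - u) \<bullet> b = (if b = e then a else 1)" if "b \<in> Basis" for b
    using that e by (auto simp: v_def inner_add_left inner_Basis)
  have "emeasure lborel (box u v) = (\<Prod>b\<in>Basis. (v - u) \<bullet> b)"
    using diff \<open>0 \<le> a\<close>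
    by (intro emeasure_lborel_box) (auto simp: inner_diff_left algebra_simps split: if_splits)
  also have "(\<Prod>b\<in>Basis. (v - u) \<bullet> b) = (\<Prod>b\<in>Basis. if b = e then a else 1)"
    using diff by (intro prod.cong) auto
  also have "\<dots> = a"
    using e by (simp add: prod.delta)
  finally have "emeasure lborel (box u v) = ennreal a" .
  moreover have "x \<notin> K" if "x \<in> box u v" for x
  proof
    assume "x \<in> K"
    have "r < x \<bullet> e"
      using that e by (auto simp: mem_box u_def)
    also have "\<dots> \<le> norm x"
      using e Basis_le_norm[OF e, of x] by simp
    finally show False
      using r[OF \<open>x \<in> K\<close>] by simp
  qed
  ultimately show thesis
    by (intro that[of "box u v"]) auto
qed

text \<open>Two bounded sets of equal volume at most 1 have a common complement of volume \<open>1 - a\<close>, placed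
  far away from both; hence the measure of a bounded set is a function \<open>g\<close> of its volume.
  This \<open>g\<close> is additive and monotone on \<open>[0, 1]\<close>, hence linear.\<close>

lemma bounded_emeasure_lborel_le_1:
  fixes \<mu> :: "'a::euclidean_space measure"
  assumes sets: "sets \<mu> = sets borel"
    and unit: "\<And>A. A \<in> sets borel \<Longrightarrow> emeasure lborel A = 1 \<Longrightarrow> emeasure \<mu> A = ennreal \<beta>"
    and "0 \<le> \<beta>"
    and A: "A \<in> sets borel" "bounded A" "emeasure lborel A = ennreal a" "0 \<le> a" "a \<le> 1"
  shows "emeasure \<mu> A = ennreal (\<beta> * a)"
proof -
  \<comment> \<open>A single \<open>D\<close> serves all members of the finite family: to compare
    two sets of equal volume, both must be completed by the same set.\<close>
  have ext: "\<exists>D. D \<in> sets borel \<and> bounded D \<and> emeasure lborel D = ennreal b \<and>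
      (\<forall>A\<in>\<A>. A \<inter> D = {} \<and> emeasure \<mu> (A \<union> D) = emeasure \<mu> A + emeasure \<mu> D \<and>
        (\<forall>a\<ge>0. emeasure lborel A = ennreal a \<longrightarrow> emeasure lborel (A \<union> D) = ennreal (a + b)))"
    if \<A>: "finite \<A>" "\<forall>A\<in>\<A>. A \<in> sets borel \<and> bounded A" "0 \<le> b" for \<A> b
  proof -
    obtain D where D: "D \<in> sets borel" "bounded D" "emeasure lborel D = ennreal b" "\<Union>\<A> \<inter> D = {}"
      using ex_disjoint_lborel[of "\<Union>\<A>" b] \<A> by (metis bounded_Union)
    have "A \<inter> D = {} \<and> emeasure \<mu> (A \<union> D) = emeasure \<mu> A + emeasure \<mu> D \<and>
        (\<forall>a\<ge>0. emeasure lborel A = ennreal a \<longrightarrow> emeasure lborel (A \<union> D) = ennreal (a + b))"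
      if "A \<in> \<A>" for A
    proof -
      have [measurable]: "A \<in> sets borel" "A \<in> sets \<mu>" "D \<in> sets \<mu>" and dis: "A \<inter> D = {}"
        using that D \<A>(2) sets by auto
      then show ?thesis
        using D \<open>0 \<le> b\<close> by (auto simp: plus_emeasure[symmetric])
    qed
    then show ?thesis
      using D by blast
  qed
  \<comment> \<open>Completing \<open>A\<close> to volume 1 bounds its measure by \<beta>.
    Finiteness is what permits cancelling \<open>D\<close> in \<open>same\<close> and passing to the
    real-valued \<open>g\<close>.\<close>
  have fin: "emeasure \<mu> A < \<infinity>"
    if A: "A \<in> sets borel" "bounded A" "emeasure lborel A = ennreal a" "0 \<le> a" "a \<le> 1" for A a
  proof -
    obtain D where D: "D \<in> sets borel" "emeasure \<mu> (A \<union> D) = emeasure \<mu> A + emeasure \<mu> D"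
      "emeasure lborel (A \<union> D) = ennreal (a + (1 - a))"
      using ext[of "{A}" "1 - a"] A by auto
    then have "emeasure \<mu> A + emeasure \<mu> D = ennreal \<beta>"
      using unit[of "A \<union> D"] A by simp
    then show ?thesis
      by (metis ennreal_add_eq_top ennreal_neq_top infinity_ennreal_def less_top)
  qed
  have same: "emeasure \<mu> A = emeasure \<mu> B"
    if AB: "A \<in> sets borel" "bounded A" "emeasure lborel A = ennreal a"
      "B \<in> sets borel" "bounded B" "emeasure lborel B = ennreal a" "0 \<le> a" "a \<le> 1" for A B a
  proof -
    obtain D where D: "D \<in> sets borel" "bounded D" "emeasure lborel D = ennreal (1 - a)"
      "emeasure \<mu> (A \<union> D) = emeasure \<mu> A + emeasure \<mu> D"
      "emeasure \<mu> (B \<union> D) = emeasure \<mu> B + emeasure \<mu> D"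
      "emeasure lborel (A \<union> D) = ennreal (a + (1 - a))"
      "emeasure lborel (B \<union> D) = ennreal (a + (1 - a))"
      using ext[of "{A, B}" "1 - a"] AB
      by (metis diff_ge_0_iff_ge finite.emptyI finite.insertI insert_iff singletonD)
    then have "emeasure \<mu> A + emeasure \<mu> D = emeasure \<mu> B + emeasure \<mu> D"
      using unit[of "A \<union> D"] unit[of "B \<union> D"] AB by simp
    moreover have "emeasure \<mu> D < \<infinity>"
      using fin[of D "1 - a"] D AB by simp
    ultimately show ?thesis
      by (auto simp: ennreal_add_left_cancel add.commute)
  qed
  \<comment> \<open>A representative of each volume; by \<open>same\<close>, the choice does not
    affect \<open>g\<close> on [0, 1].\<close>
  define R :: "real \<Rightarrow> 'a set" where "R a = (SOME D. D \<in> sets borel \<and> bounded D \<and> emeasure lborel D = ennreal a)" for a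
  have R: "R a \<in> sets borel" "bounded (R a)" "emeasure lborel (R a) = ennreal a" if "0 \<le> a" for a
  proof -
    have "\<exists>D. D \<in> sets borel \<and> bounded D \<and> emeasure lborel D = ennreal a"
      using ex_disjoint_lborel[of "{}" a] that by (metis bounded_empty)
    from someI_ex[OF this]
    show "R a \<in> sets borel" "bounded (R a)" "emeasure lborel (R a) = ennreal a"
      unfolding R_def by auto
  qed
  define g where "g a = measure \<mu> (R a)" for a :: real
  have g: "emeasure \<mu> A = ennreal (g a)"
    if "A \<in> sets borel" "bounded A" "emeasure lborel A = ennreal a" "0 \<le> a" "a \<le> 1" for A a
    using same[of A a "R a"] fin[of A a] R[of a] that
    by (simp add: g_def measure_def)
  have g_nonneg: "0 \<le> g a" for a
    by (simp add: g_def)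
  \<comment> \<open>The volume \<open>b\<close> is realised by a set disjoint from
    \<open>R a\<close>, so additivity of \<mu> carries over to \<open>g\<close>.\<close>
  have g_add: "g (a + b) = g a + g b" if ab: "0 \<le> a" "0 \<le> b" "a + b \<le> 1" for a b
  proof -
    obtain D where D: "D \<in> sets borel" "bounded D" "emeasure lborel D = ennreal b"
      "emeasure \<mu> (R a \<union> D) = emeasure \<mu> (R a) + emeasure \<mu> D"
      "emeasure lborel (R a \<union> D) = ennreal (a + b)"
      using ext[of "{R a}" b] R[of a] ab by auto
    then have "ennreal (g (a + b)) = ennreal (g a) + ennreal (g b)"
      using g[of "R a" a] g[of D b] g[of "R a \<union> D" "a + b"] R[of a] ab by simp
    then show ?thesis
      using g_nonneg by (simp flip: ennreal_plus)
  qed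
  have g_1: "g 1 = \<beta>"
    using unit[of "R 1"] R[of 1] g[of "R 1" 1] g_nonneg[of 1] \<open>0 \<le> \<beta>\<close> by simp
  have g_mult: "real m * a \<le> 1 \<Longrightarrow> g (real m * a) = real m * g a" if "0 \<le> a" for m a
  proof (induction m)
    case 0
    show ?case
      using g_add[of 0 0] by simp
  next
    case (Suc m)
    have "real (Suc m) * a = real m * a + a"
      by (simp add: algebra_simps)
    then show ?case
      using Suc g_add[of "real m * a" a] that by (simp add: algebra_simps)
  qed
  have g_le: "g a \<le> \<beta> * a" if "0 \<le> a" "a \<le> 1" for a
  proof -
    have le: "g a \<le> \<beta> * (a + inverse (real (Suc n)))" for n
    proof -
      \<comment> \<open>Rounding \<open>a\<close> up to a multiple of \<open>1 / Suc n\<close>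
        yields an upper bound, since \<open>g\<close> is monotone and is already known to be linear
        on such multiples. As \<open>a \<le> 1\<close>, the rounded value stays within [0, 1], where
        additivity is available.\<close>
      define m where "m = nat \<lceil>real (Suc n) * a\<rceil>"
      have m: "real (Suc n) * a \<le> real m" "real m \<le> real (Suc n) * a + 1"
        using that by (simp_all add: m_def)
      have "real (Suc n) * a \<le> real (Suc n)"
        using that by (intro mult_left_le) auto
      then have "m \<le> Suc n"
        unfolding m_def by (simp add: ceiling_le_iff nat_le_iff)
      then have m_le: "real m / real (Suc n) \<le> 1"
        by simp
      have am: "a \<le> real m / real (Suc n)"
        using m(1) by (simp add: field_simps)
      have ma: "real m / real (Suc n) \<le> a + inverse (real (Suc n))"
        using m(2) by (simp add: pos_divide_le_eq distrib_right mult.commute[of a] del: of_nat_Suc)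
      have "g (real m / real (Suc n)) = real m * g (1 / real (Suc n))"
        using g_mult[of "1 / real (Suc n)" m] m_le by simp
      moreover have "\<beta> = real (Suc n) * g (1 / real (Suc n))"
        using g_mult[of "1 / real (Suc n)" "Suc n"] g_1 by simp
      ultimately have eq: "g (real m / real (Suc n)) = \<beta> * (real m / real (Suc n))"
        by (simp del: of_nat_Suc)
      have "g a \<le> g (real m / real (Suc n))"
        using g_add[of a "real m / real (Suc n) - a"] g_nonneg m_le am that by simp
      also have "\<dots> \<le> \<beta> * (a + inverse (real (Suc n)))"
        unfolding eq using ma \<open>0 \<le> \<beta>\<close> by (intro mult_left_mono)
      finally show ?thesis .
    qed
    have "(\<lambda>n. \<beta> * (a + inverse (real (Suc n)))) \<longlonglongrightarrow> \<beta> * (a + 0)"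
      by (intro tendsto_intros LIMSEQ_inverse_real_of_nat)
    then show ?thesis
      using le by (intro LIMSEQ_le_const) auto
  qed
  \<comment> \<open>The upper bounds at \<open>a\<close> and \<open>1 - a\<close> add up to \<beta>,
    and so do the values of \<open>g\<close>; hence both bounds are attained.\<close>
  have "g a = \<beta> * a"
    using g_le[of a] g_le[of "1 - a"] g_add[of a "1 - a"] g_1 A(4,5) by (simp add: algebra_simps)
  then show ?thesis
    using g A by simp
qed

text \<open>Countably many small balls cover the space. Cutting a Borel set along the disjointed
  balls leaves bounded pieces of volume at most 1, to which the preceding lemma applies, and
  countable additivity reassembles them.\<close>

lemma eq_scale_lborel:
  fixes \<mu> :: "'a::euclidean_space measure"
  assumes sets: "sets \<mu> = sets borel"
    and unit: "\<And>A. A \<in> sets borel \<Longrightarrow> emeasure lborel A = 1 \<Longrightarrow> emeasure \<mu> A = ennreal \<beta>"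
    and "0 \<le> \<beta>"
  shows "\<mu> = scale_measure (ennreal \<beta>) lborel"
proof (rule measure_eqI)
  show "sets \<mu> = sets (scale_measure (ennreal \<beta>) lborel)"
    using sets by simp
  fix A assume "A \<in> sets \<mu>"
  then have A[measurable]: "A \<in> sets borel"
    using sets by simp
  obtain Q :: "'a set" where Q: "countable Q" "\<And>X. open X \<Longrightarrow> X \<noteq> {} \<Longrightarrow> \<exists>d\<in>Q. d \<in> X"
    using countable_dense_setE by blast
  then have "Q \<noteq> {}"
    by (metis UNIV_not_empty empty_iff open_UNIV)
  \<comment> \<open>A ball of radius 1/4 lies in a cube of side 1/2, whose volume is at most 1 in
    every dimension. Since the centres are dense, any fixed radius gives a cover.\<close>
  define C :: "nat \<Rightarrow> 'a set" where "C i = ball (from_nat_into Q i) (1/4)" for i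
  have cover: "(\<Union>i. C i) = UNIV"
  proof -
    have "\<exists>i. x \<in> C i" for x
    proof -
      obtain d where "d \<in> Q" "d \<in> ball x (1/4)"
        using Q(2)[of "ball x (1/4)"] by auto
      moreover obtain i where "from_nat_into Q i = d"
        using \<open>d \<in> Q\<close> \<open>countable Q\<close> from_nat_into_surj by metis
      ultimately show ?thesis
        by (auto simp: C_def dist_commute intro!: exI[of _ i])
    qed
    then show ?thesis
      by auto
  qed
  have C_le: "emeasure lborel (C i) \<le> 1" for i
  proof -
    define q where "q = from_nat_into Q i"
    have sub: "C i \<subseteq> cbox (q - (1/4) *\<^sub>R One) (q + (1/4) *\<^sub>R One)"
    proof
      fix x assume "x \<in> C i"
      then have "norm (x - q) < 1/4"
        by (simp add: C_def q_def dist_norm norm_minus_commute)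
      then have "(x - q) \<bullet> b \<le> 1/4 \<and> - 1/4 \<le> (x - q) \<bullet> b" if "b \<in> Basis" for b
        using Basis_le_norm[OF that, of "x - q"] by linarith
      then show "x \<in> cbox (q - (1/4) *\<^sub>R One) (q + (1/4) *\<^sub>R One)"
        by (force simp: mem_box inner_diff_left inner_add_left field_simps)
    qed
    have "emeasure lborel (C i) \<le> emeasure lborel (cbox (q - (1/4) *\<^sub>R One) (q + (1/4) *\<^sub>R One))"
      using sub by (intro emeasure_mono) auto
    also have "\<dots> = ennreal (\<Prod>b\<in>(Basis::'a set). 1/2)"
      by (subst emeasure_lborel_cbox)
        (auto simp: inner_diff_left inner_add_left intro!: arg_cong[where f = ennreal] prod.cong)
    also have "\<dots> \<le> ennreal 1"
      by (intro ennreal_leI prod_le_1) auto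
    finally show ?thesis
      by simp
  qed
  define B where "B i = A \<inter> disjointed C i" for i
  have C_sets: "range C \<subseteq> sets borel"
    by (auto simp: C_def)
  have B_sets: "B i \<in> sets borel" for i
    using sets.range_disjointed_sets[OF C_sets] by (auto simp: B_def)
  have B_sub: "B i \<subseteq> C i" for i
    using disjointed_subset[of C i] by (auto simp: B_def)
  have B_dis: "disjoint_family B"
    using disjoint_family_disjointed[of C] by (auto simp: disjoint_family_on_def B_def)
  have B_un: "(\<Union>i. B i) = A"
    using UN_disjointed_eq[of C] cover by (auto simp: B_def)
  have B_eq: "emeasure \<mu> (B i) = ennreal \<beta> * emeasure lborel (B i)" for i
  proof -
    have bd: "bounded (B i)"
      using B_sub[of i] bounded_subset[OF bounded_ball] by (auto simp: C_def)
    have le: "emeasure lborel (B i) \<le> 1"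
      using emeasure_mono[OF B_sub, of i lborel] C_le[of i] C_sets by (auto simp: image_subset_iff)
    then obtain b where b: "emeasure lborel (B i) = ennreal b" "0 \<le> b" "b \<le> 1"
      by (cases "emeasure lborel (B i)") (auto simp: top_unique)
    then show ?thesis
      using bounded_emeasure_lborel_le_1[OF sets unit \<open>0 \<le> \<beta>\<close> B_sets bd b] \<open>0 \<le> \<beta>\<close>
      by (simp add: ennreal_mult)
  qed
  have "emeasure \<mu> A = (\<Sum>i. emeasure \<mu> (B i))"
    using B_dis B_sets sets B_un by (subst suminf_emeasure) auto
  also have "\<dots> = ennreal \<beta> * (\<Sum>i. emeasure lborel (B i))"
    by (simp add: B_eq)
  also have "(\<Sum>i. emeasure lborel (B i)) = emeasure lborel A"
    using B_dis B_sets B_un by (subst suminf_emeasure) auto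
  finally show "emeasure \<mu> A = emeasure (scale_measure (ennreal \<beta>) lborel) A"
    by simp
qed

section \<open>Campbell's formula\<close>

lemma finite_configuration_Int_bounded:
  assumes "X \<in> configurations" "bounded B"
  shows "finite (X \<inter> B)"
proof -
  have "finite (X \<inter> closure B)"
    using assms by (auto simp: configurations_def compact_closure)
  then show ?thesis
    using closure_subset by (metis Int_mono finite_subset order_refl)
qed

lemma space_config_space: "space config_space = configurations"
  unfolding config_space_def by (intro space_measure_of) auto

lemma point_process_in_configurations:
  "point_process M X \<Longrightarrow> \<omega> \<in> space M \<Longrightarrow> X \<omega> \<in> configurations"
  by (auto simp: point_process_def space_config_space[symmetric] dest: measurable_space)

lemma measurable_card_config_space:
  assumes "B \<in> sets borel" "bounded B"
  shows "(\<lambda>Z. card (Z \<inter> B)) \<in> config_space \<rightarrow>\<^sub>M count_space UNIV"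
proof -
  have "(\<lambda>Z. card (Z \<inter> B)) -` {n} \<inter> space config_space \<in> sets config_space" for n
  proof -
    have "(\<lambda>Z. card (Z \<inter> B)) -` {n} \<inter> space config_space = {X \<in> configurations. card (X \<inter> B) = n}"
      by (auto simp: space_config_space)
    also have "\<dots> \<in> sets config_space"
      unfolding config_space_def using assms by (intro in_measure_of) auto
    finally show ?thesis .
  qed
  then show ?thesis
    by (subst measurable_count_space_eq2_countable) auto
qed

text \<open>On an unbounded set the count may be infinite, where \<open>card\<close> would return 0,
  so it is expressed by the counting measure. It is the increasing limit of the counts on bounded
  pieces, which are finite and measurable by the choice of generators of
  \<open>config_space\<close>.\<close>

lemma measurable_emeasure_point_process:
  fixes X :: "'w \<Rightarrow> 'b::euclidean_space set"
  assumes X: "point_process M X" and A: "A \<in> sets borel"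
  shows "(\<lambda>\<omega>. emeasure (count_space UNIV) (X \<omega> \<inter> A)) \<in> borel_measurable M"
proof -
  define B where "B n = A \<inter> ball 0 (real n)" for n
  have B: "B n \<in> sets borel" "bounded (B n)" for n
    using A by (auto simp: B_def)
  have "(\<Union>n. B n) = A"
    by (auto simp: B_def reals_Archimedean2)
  then have un: "(\<Union>n. X \<omega> \<inter> B n) = X \<omega> \<inter> A" for \<omega>
    by blast
  have inc: "incseq (\<lambda>n. X \<omega> \<inter> B n)" for \<omega>
    by (auto simp: incseq_def B_def)
  have sup: "emeasure (count_space UNIV) (X \<omega> \<inter> A) =
      (SUP n. emeasure (count_space UNIV) (X \<omega> \<inter> B n))" for \<omega>
    using SUP_emeasure_incseq[of "\<lambda>n. X \<omega> \<inter> B n" "count_space UNIV"] inc un by simp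
  have "(\<lambda>\<omega>. emeasure (count_space UNIV) (X \<omega> \<inter> B n)) \<in> borel_measurable M" for n
  proof -
    have "(\<lambda>\<omega>. card (X \<omega> \<inter> B n)) \<in> M \<rightarrow>\<^sub>M count_space UNIV"
      using X measurable_card_config_space[OF B] unfolding point_process_def
      by (rule measurable_compose)
    then have "(\<lambda>\<omega>. of_nat (card (X \<omega> \<inter> B n)) :: ennreal) \<in> borel_measurable M"
      by measurable
    moreover have "emeasure (count_space UNIV) (X \<omega> \<inter> B n) = of_nat (card (X \<omega> \<inter> B n))"
      if "\<omega> \<in> space M" for \<omega>
      using finite_configuration_Int_bounded[OF point_process_in_configurations[OF X that] B(2)] by simp
    ultimately show ?thesis
      by (subst measurable_cong) auto
  qed
  then show ?thesis
    unfolding sup by measurable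
qed

text \<open>The first moment (mean) measure of \<open>X\<close>. With \<open>measure_of\<close> it
  takes the prescribed values only once these are shown to be countably additive, which is done
  below for point processes.\<close>

definition intensity_measure :: "'w measure \<Rightarrow> ('w \<Rightarrow> 'b::euclidean_space set) \<Rightarrow> 'b measure" where
  "intensity_measure M X =
     measure_of UNIV (sets borel) (\<lambda>A. \<integral>\<^sup>+\<omega>. emeasure (count_space UNIV) (X \<omega> \<inter> A) \<partial>M)"

lemma sets_intensity_measure [measurable_cong]: "sets (intensity_measure M X) = sets borel"
  unfolding intensity_measure_def
  by (metis sets.sets_measure_of_eq space_borel)

text \<open>Counting measure is countably additive for each outcome, and the measurability of the
  counts allows exchanging the sum with the expectation.\<close>

lemma emeasure_intensity_measure:
  assumes X: "point_process M X" and A: "A \<in> sets borel"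
  shows "emeasure (intensity_measure M X) A = (\<integral>\<^sup>+\<omega>. emeasure (count_space UNIV) (X \<omega> \<inter> A) \<partial>M)"
proof (rule emeasure_measure_of[OF intensity_measure_def])
  show "sets borel \<subseteq> Pow UNIV"
    by simp
  show "A \<in> sets (intensity_measure M X)"
    using A by (simp add: sets_intensity_measure)
  show "positive (sets (intensity_measure M X)) (\<lambda>A. \<integral>\<^sup>+\<omega>. emeasure (count_space UNIV) (X \<omega> \<inter> A) \<partial>M)"
    by (simp add: positive_def)
  show "countably_additive (sets (intensity_measure M X))
      (\<lambda>A. \<integral>\<^sup>+\<omega>. emeasure (count_space UNIV) (X \<omega> \<inter> A) \<partial>M)"
  proof (rule countably_additiveI)
    fix F :: "nat \<Rightarrow> _"
    assume F: "range F \<subseteq> sets (intensity_measure M X)" "disjoint_family F"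
    have "(\<Sum>i. \<integral>\<^sup>+\<omega>. emeasure (count_space UNIV) (X \<omega> \<inter> F i) \<partial>M)
        = (\<integral>\<^sup>+\<omega>. (\<Sum>i. emeasure (count_space UNIV) (X \<omega> \<inter> F i)) \<partial>M)"
      using F(1) by (intro nn_integral_suminf[symmetric] measurable_emeasure_point_process[OF X])
        (auto simp: sets_intensity_measure)
    also have "\<dots> = (\<integral>\<^sup>+\<omega>. emeasure (count_space UNIV) (X \<omega> \<inter> \<Union>(range F)) \<partial>M)"
    proof (rule nn_integral_cong)
      fix \<omega>
      have "disjoint_family (\<lambda>i. X \<omega> \<inter> F i)"
        using F(2) by (auto simp: disjoint_family_on_def)
      then show "(\<Sum>i. emeasure (count_space UNIV) (X \<omega> \<inter> F i)) =
          emeasure (count_space UNIV) (X \<omega> \<inter> \<Union>(range F))"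
        by (subst suminf_emeasure) auto
    qed
    finally show "(\<Sum>i. \<integral>\<^sup>+\<omega>. emeasure (count_space UNIV) (X \<omega> \<inter> F i) \<partial>M) =
        (\<integral>\<^sup>+\<omega>. emeasure (count_space UNIV) (X \<omega> \<inter> \<Union>(range F)) \<partial>M)" .
  qed
qed

text \<open>Induction from indicators, where the formula defines the intensity measure, through sums
  and multiples to increasing limits. Measurability and equation are proved together, because the
  outer integral is linear and monotone-continuous only for measurable inner integrals.\<close>

lemma campbell:
  fixes f :: "'b::euclidean_space \<Rightarrow> ennreal"
  assumes X: "point_process M X" and f: "f \<in> borel_measurable borel"
  shows measurable_nn_integral_point_process:
      "(\<lambda>\<omega>. \<integral>\<^sup>+x. f x \<partial>count_space (X \<omega>)) \<in> borel_measurable M" (is "?meas f")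
    and nn_integral_point_process:
      "(\<integral>\<^sup>+\<omega>. \<integral>\<^sup>+x. f x \<partial>count_space (X \<omega>) \<partial>M) = (\<integral>\<^sup>+x. f x \<partial>intensity_measure M X)" (is "?eq f")
proof -
  have "?meas f \<and> ?eq f"
    using f
  proof (induction f rule: borel_measurable_induct)
    case (cong f g)
    then have "f = g"
      by (simp add: fun_eq_iff)
    show ?case
      unfolding \<open>f = g\<close> by (rule cong(4))
  next
    case (set A)
    have "(\<integral>\<^sup>+x. indicator A x \<partial>count_space (X \<omega>)) = emeasure (count_space UNIV) (X \<omega> \<inter> A)" for \<omega>
    proof -
      have "(\<integral>\<^sup>+x. indicator A x \<partial>count_space (X \<omega>)) =
          (\<integral>\<^sup>+x. indicator A x * indicator (X \<omega>) x \<partial>count_space UNIV)"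
        by (rule nn_integral_count_space_indicator) simp
      also have "\<dots> = (\<integral>\<^sup>+x. indicator (X \<omega> \<inter> A) x \<partial>count_space UNIV)"
        by (rule nn_integral_cong) (simp split: split_indicator)
      also have "\<dots> = emeasure (count_space UNIV) (X \<omega> \<inter> A)"
        by (rule nn_integral_indicator) simp
      finally show ?thesis .
    qed
    then show ?case
      using set measurable_emeasure_point_process[OF X, of A] emeasure_intensity_measure[OF X, of A]
      by (simp add: sets_intensity_measure)
  next
    case (mult u c)
    have "(\<integral>\<^sup>+x. c * u x \<partial>count_space (X \<omega>)) = c * (\<integral>\<^sup>+x. u x \<partial>count_space (X \<omega>))" for \<omega>
      by (intro nn_integral_cmult) auto
    with mult show ?case
      by (auto simp: nn_integral_cmult)
  next
    case (add u v)
    have "(\<integral>\<^sup>+x. v x + u x \<partial>count_space (X \<omega>)) =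
        (\<integral>\<^sup>+x. v x \<partial>count_space (X \<omega>)) + (\<integral>\<^sup>+x. u x \<partial>count_space (X \<omega>))" for \<omega>
      by (intro nn_integral_add) auto
    with add show ?case
      by (auto simp: nn_integral_add)
  next
    case (seq U)
    \<comment> \<open>Monotone convergence is used three times: for the sum over a fixed
      configuration, for the expectation, and for the intensity measure.\<close>
    have swap: "(\<integral>\<^sup>+x. (SUP i. U i x) \<partial>count_space (X \<omega>)) = (SUP i. \<integral>\<^sup>+x. U i x \<partial>count_space (X \<omega>))" for \<omega>
      using seq by (intro nn_integral_monotone_convergence_SUP) auto
    have "incseq (\<lambda>i \<omega>. \<integral>\<^sup>+x. U i x \<partial>count_space (X \<omega>))"
      using seq by (auto simp: incseq_def le_fun_def intro!: nn_integral_mono)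
    then have "(\<integral>\<^sup>+\<omega>. (SUP i. \<integral>\<^sup>+x. U i x \<partial>count_space (X \<omega>)) \<partial>M) =
        (SUP i. \<integral>\<^sup>+\<omega>. \<integral>\<^sup>+x. U i x \<partial>count_space (X \<omega>) \<partial>M)"
      using seq by (intro nn_integral_monotone_convergence_SUP) auto
    moreover have "(\<integral>\<^sup>+x. (SUP i. U i x) \<partial>intensity_measure M X) =
        (SUP i. \<integral>\<^sup>+x. U i x \<partial>intensity_measure M X)"
      using seq by (intro nn_integral_monotone_convergence_SUP) auto
    moreover have "(\<lambda>\<omega>. SUP i. \<integral>\<^sup>+x. U i x \<partial>count_space (X \<omega>)) \<in> borel_measurable M"
      using seq by (intro borel_measurable_SUP) auto
    ultimately show ?case
      using seq by (simp add: SUP_apply[abs_def] swap)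
  qed
  then show "?meas f" "?eq f"
    by auto
qed

text \<open>The intensity fixes the mean measure on sets of volume 1, which makes that measure
  \<beta> times Lebesgue measure; the claim is then Campbell's formula.\<close>

lemma has_intensity_nn_integral:
  fixes f :: "'b::euclidean_space \<Rightarrow> ennreal"
  assumes "has_intensity M X \<beta>" "f \<in> borel_measurable borel"
  shows "(\<integral>\<^sup>+\<omega>. \<integral>\<^sup>+x. f x \<partial>count_space (X \<omega>) \<partial>M) = ennreal \<beta> * (\<integral>\<^sup>+x. f x \<partial>lborel)"
proof -
  have X: "point_process M X" "0 \<le> \<beta>"
    using assms by (auto simp: has_intensity_def)
  have "intensity_measure M X = scale_measure (ennreal \<beta>) lborel"
    using assms(1) X
    by (intro eq_scale_lborel) (auto simp: sets_intensity_measure emeasure_intensity_measure has_intensity_def)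
  then show ?thesis
    using nn_integral_point_process[OF X(1) assms(2)] assms(2)
    by (simp add: nn_integral_scale_measure)
qed

section \<open>Comparison of Laplace functionals\<close>

lemma BM_plus_integrable:
  assumes "f \<in> BM_plus"
  shows "integrable lborel f"
proof -
  have f: "f \<in> borel_measurable borel" "bounded (range f)" "bounded {x. f x \<noteq> 0}"
    using assms by (auto simp: BM_plus_def)
  obtain K where K: "\<And>x. \<bar>f x\<bar> \<le> K"
    using f(2) by (auto simp: bounded_iff)
  obtain a where a: "{x. f x \<noteq> 0} \<subseteq> cbox (- a) a"
    using bounded_subset_cbox_symmetric[OF f(3)] by blast
  have "integrable lborel (\<lambda>x. K * indicator (cbox (- a) a) x :: real)"
    by (intro integrable_mult_right integrable_real_indicator) (auto simp: emeasure_lborel_cbox_eq)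
  then show ?thesis
  proof (rule Bochner_Integration.integrable_bound)
    have "norm (f x) \<le> norm (K * indicator (cbox (- a) a) x :: real)" for x
      using K[of x] a by (cases "x \<in> cbox (- a) a") auto
    then show "AE x in lborel. norm (f x) \<le> norm (K * indicator (cbox (- a) a) x :: real)"
      by simp
  qed (use f in simp)
qed

text \<open>For \<open>x \<le> y\<close>, factor out \<open>exp (- x) \<le> 1\<close> and use
  \<open>1 - exp (- u) \<le> u\<close> with \<open>u = y - x\<close>; the other case is
  symmetric.\<close>

lemma abs_exp_neg_diff_le:
  assumes "0 \<le> x" "0 \<le> y"
  shows "\<bar>exp (- x) - exp (- y)\<bar> \<le> \<bar>x - y :: real\<bar>"
proof -
  have *: "\<bar>exp (- x) - exp (- y)\<bar> \<le> y - x" if "0 \<le> x" "x \<le> y" for x y :: real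
  proof -
    have "exp (- x) - exp (- y) = exp (- x) * (1 - exp (- (y - x)))"
      by (simp add: right_diff_distrib flip: exp_add)
    also have "\<dots> \<le> 1 * (y - x)"
      using that exp_ge_add_one_self[of "- (y - x)"] by (intro mult_mono) (simp, linarith, auto)
    finally show ?thesis
      using that by simp
  qed
  show ?thesis
    using *[of x y] *[of y x] assms by (cases "x \<le> y") auto
qed

text \<open>The support of \<open>f\<close> is bounded and so contains only finitely many points of
  a configuration. Hence the Bochner integral in the Laplace functional is a true sum and not the
  default value 0, and it agrees with the non-negative integral of Campbell's formula.\<close>

lemma integral_count_space_BM_plus:
  assumes "f \<in> BM_plus" "X \<in> configurations"
  shows "finite (X \<inter> {x. f x \<noteq> 0})"
    and "(\<integral>x. f x \<partial>count_space X) = (\<Sum>x\<in>X \<inter> {x. f x \<noteq> 0}. f x)"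
    and "(\<integral>\<^sup>+x. ennreal (f x) \<partial>count_space X) = ennreal (\<integral>x. f x \<partial>count_space X)"
proof -
  show fin: "finite (X \<inter> {x. f x \<noteq> 0})"
    using assms by (intro finite_configuration_Int_bounded) (auto simp: BM_plus_def)
  show sum: "(\<integral>x. f x \<partial>count_space X) = (\<Sum>x\<in>X \<inter> {x. f x \<noteq> 0}. f x)"
    using fin by (subst lebesgue_integral_count_space_finite_support) (auto simp: Int_def)
  have "\<And>x. 0 \<le> f x"
    using assms by (simp add: BM_plus_def)
  \<comment> \<open>Both counting measures are restrictions of the one on \<open>UNIV\<close>;
    multiplied by the two indicators, \<open>f\<close> gives the same function, since it vanishes on
    the rest of \<open>X\<close>.\<close>
  have "integrable (count_space X) f"
  proof -
    have "integrable (count_space (X \<inter> {x. f x \<noteq> 0})) f"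
      using fin by (rule integrable_count_space)
    then have "integrable (count_space UNIV) (\<lambda>x. indicator (X \<inter> {x. f x \<noteq> 0}) x *\<^sub>R f x)"
      using integrable_restrict_space[of "X \<inter> {x. f x \<noteq> 0}" "count_space UNIV" f]
      by (simp add: restrict_count_space)
    also have "(\<lambda>x. indicator (X \<inter> {x. f x \<noteq> 0}) x *\<^sub>R f x) = (\<lambda>x. indicator X x *\<^sub>R f x)"
      by (auto simp: indicator_def)
    finally show ?thesis
      using integrable_restrict_space[of X "count_space UNIV" f] by (simp add: restrict_count_space)
  qed
  then show "(\<integral>\<^sup>+x. ennreal (f x) \<partial>count_space X) = ennreal (\<integral>x. f x \<partial>count_space X)"
    using \<open>\<And>x. 0 \<le> f x\<close> by (intro nn_integral_eq_integral) auto
qed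

text \<open>Points common to \<open>X\<close> and \<open>Y\<close> cancel. What remains is a
  difference of two non-negative sums, over \<open>X - Y\<close> and \<open>Y - X\<close>, bounded
  in absolute value by their sum.\<close>

lemma abs_integral_count_space_diff_le:
  assumes f: "f \<in> BM_plus" and X: "X \<in> configurations" and Y: "Y \<in> configurations"
    and XY: "sym_diff X Y \<in> configurations"
  shows "\<bar>(\<integral>x. f x \<partial>count_space X) - (\<integral>x. f x \<partial>count_space Y)\<bar> \<le> (\<integral>x. f x \<partial>count_space (sym_diff X Y))"
proof -
  let ?X = "X \<inter> {x. f x \<noteq> 0}" and ?Y = "Y \<inter> {x. f x \<noteq> 0}"
  have nonneg: "\<And>x. 0 \<le> f x"
    using f by (simp add: BM_plus_def)
  have fin: "finite ?X" "finite ?Y"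
    using integral_count_space_BM_plus(1)[OF f] X Y by auto
  have "sum f ?X = sum f (?X - ?Y) + sum f (?X \<inter> ?Y)"
    "sum f ?Y = sum f (?Y - ?X) + sum f (?Y \<inter> ?X)"
    using sum.Int_Diff[OF fin(1), of f ?Y] sum.Int_Diff[OF fin(2), of f ?X] by simp_all
  moreover have "sum f (sym_diff X Y \<inter> {x. f x \<noteq> 0}) = sum f (?X - ?Y) + sum f (?Y - ?X)"
  proof -
    have "sym_diff X Y \<inter> {x. f x \<noteq> 0} = (?X - ?Y) \<union> (?Y - ?X)"
      by blast
    then show ?thesis
      using sum.union_disjoint[of "?X - ?Y" "?Y - ?X" f] fin by fastforce
  qed
  moreover have "0 \<le> sum f (?X - ?Y)" "0 \<le> sum f (?Y - ?X)"
    using nonneg by (auto intro: sum_nonneg)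
  ultimately show ?thesis
    using integral_count_space_BM_plus(2)[OF f] X Y XY by (simp add: Int_commute)
qed

text \<open>The exponential lies between 0 and 1, so only measurability is at stake. It is known for
  the non-negative integral and reaches the Bochner integral through
  \<open>enn2real\<close>.\<close>

lemma integrable_exp_neg_count_space:
  assumes "prob_space M" "point_process M X" "f \<in> BM_plus"
  shows "integrable M (\<lambda>\<omega>. exp (- (\<integral>x. f x \<partial>count_space (X \<omega>))))"
proof -
  interpret prob_space M by fact
  have f: "(\<lambda>x. ennreal (f x)) \<in> borel_measurable borel" "\<And>x. 0 \<le> f x"
    using assms by (auto simp: BM_plus_def)
  have "(\<lambda>\<omega>. enn2real (\<integral>\<^sup>+x. ennreal (f x) \<partial>count_space (X \<omega>))) \<in> borel_measurable M"
    using measurable_nn_integral_point_process[OF assms(2) f(1)] by measurable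
  also have "?this \<longleftrightarrow> (\<lambda>\<omega>. \<integral>x. f x \<partial>count_space (X \<omega>)) \<in> borel_measurable M"
    using assms f by (intro measurable_cong)
      (simp add: integral_count_space_BM_plus(3) point_process_in_configurations integral_nonneg_AE)
  finally have "(\<lambda>\<omega>. \<integral>x. f x \<partial>count_space (X \<omega>)) \<in> borel_measurable M" .
  then show ?thesis
    using f by (intro integrable_const_bound[where B = 1]) (auto simp: integral_nonneg_AE)
qed

text \<open>Both processes live on one probability space, so the difference of expectations is the
  expectation of a difference, which the Lipschitz bound controls outcome by outcome.\<close>

lemma laplace_functional_diff_le:
  fixes f :: "'a::euclidean_space \<Rightarrow> real"
  assumes M: "prob_space M" and X: "point_process M X" and Y: "point_process M Y"
    and Z: "has_intensity M (\<lambda>\<omega>. sym_diff (X \<omega>) (Y \<omega>)) \<beta>" and f: "f \<in> BM_plus"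
  shows "\<bar>laplace_functional M X f - laplace_functional M Y f\<bar> \<le> (\<integral>x. f x \<partial>lborel) * \<beta>"
proof -
  let ?F = "\<lambda>Z. \<integral>x. f x \<partial>count_space Z" and ?Z = "\<lambda>\<omega>. sym_diff (X \<omega>) (Y \<omega>)"
  have f': "(\<lambda>x. ennreal (f x)) \<in> borel_measurable borel" "\<And>x. 0 \<le> f x"
    using f by (auto simp: BM_plus_def)
  have Z': "point_process M ?Z" "0 \<le> \<beta>"
    using Z by (auto simp: has_intensity_def)
  note int = integrable_exp_neg_count_space[OF M X f] integrable_exp_neg_count_space[OF M Y f]
  \<comment> \<open>The chain runs in \<open>ennreal\<close>, where the expected sum over the
    symmetric difference makes sense before Campbell's formula shows it to be finite.\<close>
  have "ennreal \<bar>laplace_functional M X f - laplace_functional M Y f\<bar>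
      = ennreal (norm (\<integral>\<omega>. exp (- ?F (X \<omega>)) - exp (- ?F (Y \<omega>)) \<partial>M))"
    using int by (simp add: laplace_functional_def)
  also have "\<dots> \<le> (\<integral>\<^sup>+\<omega>. ennreal (norm (exp (- ?F (X \<omega>)) - exp (- ?F (Y \<omega>)))) \<partial>M)"
    using int by (intro integral_norm_bound_ennreal) auto
  also have "\<dots> \<le> (\<integral>\<^sup>+\<omega>. \<integral>\<^sup>+x. ennreal (f x) \<partial>count_space (?Z \<omega>) \<partial>M)"
  proof (rule nn_integral_mono)
    fix \<omega> assume \<omega>: "\<omega> \<in> space M"
    note conf = point_process_in_configurations[OF X \<omega>] point_process_in_configurations[OF Y \<omega>]
      point_process_in_configurations[OF Z'(1) \<omega>]
    have "\<bar>exp (- ?F (X \<omega>)) - exp (- ?F (Y \<omega>))\<bar> \<le> \<bar>?F (X \<omega>) - ?F (Y \<omega>)\<bar>"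
      using f' by (intro abs_exp_neg_diff_le) (auto intro: integral_nonneg_AE)
    also have "\<dots> \<le> ?F (?Z \<omega>)"
      using abs_integral_count_space_diff_le[OF f conf] .
    finally show "ennreal (norm (exp (- ?F (X \<omega>)) - exp (- ?F (Y \<omega>))))
        \<le> (\<integral>\<^sup>+x. ennreal (f x) \<partial>count_space (?Z \<omega>))"
      using integral_count_space_BM_plus(3)[OF f conf(3)] by (simp add: ennreal_leI)
  qed
  also have "\<dots> = ennreal \<beta> * (\<integral>\<^sup>+x. ennreal (f x) \<partial>lborel)"
    by (rule has_intensity_nn_integral[OF Z f'(1)])
  also have "\<dots> = ennreal ((\<integral>x. f x \<partial>lborel) * \<beta>)"
    using BM_plus_integrable[OF f] f' Z'
    by (simp add: nn_integral_eq_integral ennreal_mult mult.commute integral_nonneg_AE)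
  finally show ?thesis
    using f' Z' by (simp add: integral_nonneg_AE)
qed

theorem lemma3p4:
  fixes M :: "'w measure"
    and \<rho> c :: real
    and N :: "'w \<Rightarrow> ('a::euclidean_space \<times> real) set"
    and J :: "'w \<Rightarrow> 'a \<times> real \<Rightarrow> 'a \<times> real \<Rightarrow> bool"
    and \<Upsilon> :: "real \<Rightarrow> 'w \<Rightarrow> 'a set"
    and N' :: "'w \<Rightarrow> ('a \<times> real) set"
    and I :: "'w \<Rightarrow> 'a \<times> real \<Rightarrow> 'a \<times> real \<Rightarrow> bool"
    and \<eta> \<eta>h S :: "real \<Rightarrow> 'w \<Rightarrow> 'a set"
    and \<beta> :: "real \<Rightarrow> real"
    and f :: "'a \<Rightarrow> real"
    and t :: real
  assumes "prob_space M"
    and "0 \<le> \<rho>" "\<rho> \<le> 1"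
    and regime: "stationary_regime M \<rho> N J \<Upsilon>"
    and driving: "common_driving M \<rho> N' I (\<eta> 0) (\<eta>h 0)"
    and processes: "hard_core_process M N' I 0 \<eta>" "hard_core_process M N' I 0 \<eta>h"
    and initial: "stationary M (\<eta> 0)" "ergodic M (\<eta> 0)" "AE \<omega> in M. hard_core (\<eta> 0 \<omega>)"
    and initial_h: "AE \<omega> in M. \<eta>h 0 \<omega> = \<Upsilon> 0 \<omega>"
    and joint: "jointly_stationary M (\<eta> 0) (\<eta>h 0)"
    and S: "\<And>s \<omega>. S s \<omega> = sym_diff (\<eta> s \<omega>) (\<eta>h s \<omega>)"
    and intensity: "\<And>s. 0 \<le> s \<Longrightarrow> has_intensity M (S s) (\<beta> s)"
    and "0 < c"
    and decay: "\<And>s. 0 \<le> s \<Longrightarrow> \<beta> s \<le> \<beta> 0 * exp (- c * s)"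
    and "f \<in> BM_plus" "0 \<le> t"
  shows "\<bar>laplace_functional M (\<eta> t) f - laplace_functional M (\<eta>h t) f\<bar>
           \<le> (\<integral>x. \<bar>f x\<bar> \<partial>lborel) * \<beta> 0 * exp (- c * t)"
proof -
  have X: "point_process M (\<eta> t)" "point_process M (\<eta>h t)"
    using processes \<open>0 \<le> t\<close> by (auto simp: hard_core_process_def)
  have f: "\<And>x. 0 \<le> f x"
    using \<open>f \<in> BM_plus\<close> by (simp add: BM_plus_def)
  have "S t = (\<lambda>\<omega>. sym_diff (\<eta> t \<omega>) (\<eta>h t \<omega>))"
    using S by auto
  then have "\<bar>laplace_functional M (\<eta> t) f - laplace_functional M (\<eta>h t) f\<bar> \<le> (\<integral>x. f x \<partial>lborel) * \<beta> t"
    using intensity[OF \<open>0 \<le> t\<close>] X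
    by (intro laplace_functional_diff_le[OF \<open>prob_space M\<close>]) (simp_all add: \<open>f \<in> BM_plus\<close>)
  \<comment> \<open>The comparison so far concerns the fixed time \<open>t\<close>; the exponential
    rate enters here, through the intensity at that time.\<close>
  also have "\<dots> \<le> (\<integral>x. f x \<partial>lborel) * (\<beta> 0 * exp (- c * t))"
    using decay[OF \<open>0 \<le> t\<close>] f by (intro mult_left_mono) (simp_all add: integral_nonneg_AE)
  \<comment> \<open>As \<open>f\<close> is non-negative, its integral is its L1 norm.\<close>
  finally show ?thesis
    using f by (simp add: mult.assoc)
qed

end
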